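(* For fixed rational numbers $r$ and $s$, \[ \Delta(q;r+sq,1) = R(r,s) + O_{r,s}\bigg( \frac{\log q}q \bigg) \] as $q$ tends to infinity within the set $Q(r,s)$.
   Context: $Q(r,s)$ is the set of positive integers $q$ such that $r+sq\in\mathbb Z$, $(r+sq,q)=1$, and $x^2\equiv r+sq\pmod q$ has no solution. $\Lambda$ is von Mangoldt's function. For a reduced residue $a\bmod q$, let $r_1,r_2$ be the least positive residues of $a$ and $a^{-1}$ modulo $q$, and \[ \Delta(q;a,1)=K_q(a-1)+\iota_q(-a)\log2+\frac{\Lambda(r_1)}{r_1}+\frac{\Lambda(r_2)}{r_2}+H(q;a,1), \] where $\iota_q(n)=1$ if $n\equiv1\pmod q$ and $0$ otherwise; $K_q(n)=\frac{\Lambda(q/(q,n))}{\phi(q/(q,n))}-\frac{\Lambda(q)}{\phi(q)}$; for a prime $p$ with $p^\nu\parallel q$ and reduced residue $t$, $e(q;p,t)=\min\{e\ge1:p^e\equiv t^{-1}\pmod{q/p^\nu}\}$ ($=\infty$ if none), $h(q;p,t)=\frac{1}{\phi(p^\nu)}\frac{\log p}{p^{e(q;p,t)}}$ ($=0$ if $e=\infty$), and $H(q;a,1)=\sum_{p\mid q}(h(q;p,a)+h(q;p,a^{-1}))$. The rating $R(r,s)$ is defined as follows. If the denominator of $s$ is a prime power $p^k$ with $k\ge1$: if $r=p^j$ for some integer $j\ge1$ then $R(r,s)=\frac{\log p}{\phi(p^{j+k})}$; if $r=1$ or $r=1/p^j$ for some integer $1\le j<k$ then $R(r,s)=\frac{\log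 p}{\phi(p^k)}$; if $r=1/p^k$ then $R(r,s)=\frac{\log p}{p^k}$; otherwise $R(r,s)=0$. If $s$ is an integer: if $r=-1$ then $R(r,s)=\log 2$; if $r=p^j$ is a prime power with $j\ge1$ then $R(r,s)=\frac{\log p}{p^j}$; otherwise $R(r,s)=0$. For all other $s$, $R(r,s)=0$. *)

theory Defs
  imports
    Complex_Main
    "HOL-Number_Theory.Number_Theory"
    "HOL-Library.Landau_Symbols"
    "HOL-Library.Extended_Nat"
begin

definition Q_set :: "rat \<Rightarrow> rat \<Rightarrow> nat set" where
  "Q_set r s = {q. q > 0 \<and>
     (\<exists>a::int. of_int a = r + s * of_nat q \<and> coprime a (int q) \<and> \<not> QuadRes (int q) a)}"

definition least_pos_residue :: "nat \<Rightarrow> int \<Rightarrow> nat" where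
  "least_pos_residue q a = (LEAST m::nat. m > 0 \<and> [int m = a] (mod int q))"

definition iota :: "nat \<Rightarrow> int \<Rightarrow> real" where
  "iota q n = (if [n = 1] (mod int q) then 1 else 0)"

definition K :: "nat \<Rightarrow> int \<Rightarrow> real" where
  "K q n = (let d = q div nat (gcd (int q) n)
            in mangoldt d / real (totient d) - mangoldt q / real (totient q))"

text \<open>For the next two definitions, \<open>p ^ multiplicity p q\<close> is the exact power of
  \<open>p\<close> dividing \<open>q\<close>; the infimum of the empty set in \<^typ>\<open>enat\<close> is \<open>\<infinity>\<close>.\<close>

definition e_exp :: "nat \<Rightarrow> nat \<Rightarrow> int \<Rightarrow> enat" where
  "e_exp q p t = (let m = int (q div p ^ multiplicity p q)
                  in Inf {enat e | e. e \<ge> 1 \<and> [int p ^ e = modular_inverse m t] (mod m)})"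

definition h :: "nat \<Rightarrow> nat \<Rightarrow> int \<Rightarrow> real" where
  "h q p t = (case e_exp q p t of
       enat e \<Rightarrow> 1 / real (totient (p ^ multiplicity p q)) * (ln (real p) / real p ^ e)
     | \<infinity> \<Rightarrow> 0)"

text \<open>\<open>H q a\<close> and \<open>Delta q a\<close> are the quantities $H(q;a,1)$ and $\Delta(q;a,1)$.\<close>

definition H :: "nat \<Rightarrow> int \<Rightarrow> real" where
  "H q a = (\<Sum>p\<in>prime_factors q. h q p a + h q p (modular_inverse (int q) a))"

definition Delta :: "nat \<Rightarrow> int \<Rightarrow> real" where
  "Delta q a =
     (let r1 = least_pos_residue q a;
          r2 = least_pos_residue q (modular_inverse (int q) a)
      in K q (a - 1) + iota q (- a) * ln 2
           + mangoldt r1 / real r1 + mangoldt r2 / real r2 + H q a)"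

text \<open>The lemmas after the definition of the rating restate it case by case, with the prime
  and the exponents given explicitly.\<close>

definition denom :: "rat \<Rightarrow> nat" where
  "denom s = nat (snd (quotient_of s))"

definition rating :: "rat \<Rightarrow> rat \<Rightarrow> real" where
  "rating r s =
     (if primepow (denom s) then
        let p = aprimedivisor (denom s); k = multiplicity p (denom s) in
        if \<exists>j\<ge>1. r = of_nat p ^ j then
          ln (real p) / real (totient (p ^ ((THE j. r = of_nat p ^ j) + k)))
        else if r = 1 \<or> (\<exists>j. 1 \<le> j \<and> j < k \<and> r = 1 / of_nat p ^ j) then
          ln (real p) / real (totient (p ^ k))
        else if r = 1 / of_nat p ^ k then ln (real p) / real p ^ k
        else 0
      else if s \<in> \<int> then
        if r = -1 then ln 2
        else if r \<in> \<nat> \<and> primepow (nat \<lfloor>r\<rfloor>) then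
          ln (real (aprimedivisor (nat \<lfloor>r\<rfloor>))) / real (nat \<lfloor>r\<rfloor>)
        else 0
      else 0)"

lemma prime_power_eq_iff_rat:
  assumes "prime (p::nat)"
  shows "(of_nat p ^ i = (of_nat p ^ j :: rat)) \<longleftrightarrow> i = j"
proof -
  have "(of_nat p ^ i = (of_nat p ^ j :: rat)) \<longleftrightarrow> p ^ i = p ^ j"
    by (metis of_nat_eq_iff of_nat_power)
  thus ?thesis using prime_gt_1_nat[OF assms] by (simp add: power_inject_exp)
qed

lemma prime_power_ne_inverse_rat:
  assumes "prime (p::nat)" "j \<ge> 1"
  shows "(1 / of_nat p ^ i :: rat) \<noteq> of_nat p ^ j"
proof
  assume "(1 / of_nat p ^ i :: rat) = of_nat p ^ j"
  hence "(of_nat p ^ (i + j) :: rat) = of_nat p ^ 0"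
    using prime_gt_0_nat[OF assms(1)] by (simp add: field_simps power_add)
  thus False using prime_power_eq_iff_rat[OF assms(1)] assms(2) by (metis add_is_0 not_one_le_zero)
qed

lemma denom_Ints:
  assumes "s \<in> \<int>"
  shows "denom s = 1"
  using assms by (auto simp: denom_def elim!: Ints_cases)

context
  fixes p k :: nat and s :: rat
  assumes p: "prime p" and k: "k \<ge> 1" and denom: "denom s = p ^ k"
begin

private lemma facts:
  "primepow (denom s)" "aprimedivisor (denom s) = p" "multiplicity p (denom s) = k"
  using p k denom by (auto intro: aprimedivisor_prime_power simp: prime_imp_prime_elem)

lemma rating_denom_prime_power:
  assumes "j \<ge> 1"
  shows "rating (of_nat p ^ j) s = ln (real p) / real (totient (p ^ (j + k)))"
  using assms unfolding rating_def
  by (auto simp: facts Let_def prime_power_eq_iff_rat[OF p])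

lemma rating_denom_one: "rating 1 s = ln (real p) / real (totient (p ^ k))"
proof -
  have "\<not> (\<exists>j\<ge>1. (1::rat) = of_nat p ^ j)"
    using prime_power_ne_inverse_rat[OF p, of _ 0] by auto
  thus ?thesis unfolding rating_def facts(2,3) Let_def if_P[OF facts(1)] by (subst if_not_P) simp_all
qed

lemma rating_denom_inverse:
  assumes "1 \<le> j" "j < k"
  shows "rating (1 / of_nat p ^ j) s = ln (real p) / real (totient (p ^ k))"
proof -
  have "\<not> (\<exists>i\<ge>1. (1 / of_nat p ^ j :: rat) = of_nat p ^ i)"
    using prime_power_ne_inverse_rat[OF p] by auto
  thus ?thesis using assms unfolding rating_def facts(2,3) Let_def if_P[OF facts(1)]
    by (subst if_not_P) auto
qed

lemma rating_denom_inverse_eq: "rating (1 / of_nat p ^ k) s = ln (real p) / real p ^ k"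
proof -
  have 1: "\<not> (\<exists>i\<ge>1. (1 / of_nat p ^ k :: rat) = of_nat p ^ i)"
    using prime_power_ne_inverse_rat[OF p] by auto
  have 2: "(1 / of_nat p ^ k :: rat) = 1 / of_nat p ^ j \<longleftrightarrow> k = j" for j
    using prime_power_eq_iff_rat[OF p, of k j] prime_gt_0_nat[OF p] by (auto simp: field_simps)
  have 3: "(1 / of_nat p ^ k :: rat) \<noteq> 1"
    using 2[of 0] k by simp
  have 4: "\<not> ((1 / of_nat p ^ k :: rat) = 1 \<or>
      (\<exists>j. 1 \<le> j \<and> j < k \<and> (1 / of_nat p ^ k :: rat) = 1 / of_nat p ^ j))"
    unfolding 2 using 3 by blast
  show ?thesis
    unfolding rating_def facts(2,3) Let_def if_P[OF facts(1)] if_not_P[OF 1] if_not_P[OF 4]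
    by simp
qed

lemma rating_denom_other:
  assumes "\<And>j. j \<ge> 1 \<Longrightarrow> r \<noteq> of_nat p ^ j" "r \<noteq> 1"
    "\<And>j. 1 \<le> j \<Longrightarrow> j \<le> k \<Longrightarrow> r \<noteq> 1 / of_nat p ^ j"
  shows "rating r s = 0"
proof -
  have 1: "\<not> (\<exists>j\<ge>1. r = of_nat p ^ j)" using assms(1) by blast
  have 2: "\<not> (r = 1 \<or> (\<exists>j. 1 \<le> j \<and> j < k \<and> r = 1 / of_nat p ^ j))"
    using assms(2,3) less_imp_le by blast
  have 3: "r \<noteq> 1 / of_nat p ^ k" using assms(3) k by blast
  show ?thesis
    unfolding rating_def facts(2,3) Let_def if_P[OF facts(1)]
      if_not_P[OF 1] if_not_P[OF 2] if_not_P[OF 3] ..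
qed

end

lemma rating_Ints_minus_one: "s \<in> \<int> \<Longrightarrow> rating (-1) s = ln 2"
  by (simp add: rating_def denom_Ints)

lemma rating_Ints_prime_power:
  assumes "s \<in> \<int>" "prime p" "j \<ge> 1"
  shows "rating (of_nat p ^ j) s = ln (real p) / real p ^ j"
proof -
  have 1: "(of_nat p ^ j :: rat) = of_nat (p ^ j)" by simp
  have 2: "primepow (p ^ j)" "aprimedivisor (p ^ j) = p"
    using assms by (auto intro: aprimedivisor_prime_power)
  have 3: "(of_nat (p ^ j) :: rat) \<noteq> -1"
    by (metis neg_numeral_less_zero of_nat_less_0_iff of_nat_0_le_iff not_less
          neg_less_0_iff_less zero_less_one)
  have 4: "nat \<lfloor>of_nat (p ^ j) :: rat\<rfloor> = p ^ j" by (simp only: floor_of_nat nat_int)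
  show ?thesis unfolding rating_def 1 4 using 2 3 assms(1)
    by (simp add: denom_Ints del: of_nat_power)
qed

lemma rating_Ints_other:
  assumes "s \<in> \<int>" "r \<noteq> -1" "\<And>p j. prime (p::nat) \<Longrightarrow> j \<ge> 1 \<Longrightarrow> r \<noteq> of_nat p ^ j"
  shows "rating r s = 0"
proof -
  have "\<not> (r \<in> \<nat> \<and> primepow (nat \<lfloor>r\<rfloor>))"
  proof
    assume *: "r \<in> \<nat> \<and> primepow (nat \<lfloor>r\<rfloor>)"
    then obtain n where n: "r = of_nat n" by (auto elim: Nats_cases)
    with * have "primepow n" by simp
    then obtain p j where "prime (p::nat)" "j \<ge> 1" "n = p ^ j"
      unfolding primepow_def by (metis One_nat_def Suc_leI)
    with assms(3)[of p j] n show False by simp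
  qed
  thus ?thesis using assms by (auto simp: rating_def denom_Ints)
qed

lemma rating_other:
  assumes "\<not> primepow (denom s)" "s \<notin> \<int>"
  shows "rating r s = 0"
  using assms by (simp add: rating_def)

end

theory Submission
  imports Defs
begin

text \<open>
  Write \<open>r = c / f\<close> and \<open>s = b / d\<close> in lowest terms and \<open>a = r + s q\<close>, so that
  \<open>d f a = d c + f b q\<close> and \<open>f\<close> divides \<open>d\<close>. Each summand of \<open>\<Delta>(q;a,1)\<close> is governed by a
  congruence involving \<open>a\<close> modulo \<open>q\<close> or modulo \<open>m = q / p\<^sup>\<nu>\<close>. Multiplying it by \<open>d f\<close>
  eliminates \<open>a\<close> and makes the modulus divide a fixed expression such as \<open>d (c - f)\<close>,
  \<open>d (c \<rho> - f)\<close> or \<open>d (c p\<^sup>e - f)\<close>. If this expression is nonzero, then \<open>\<rho>\<close>, respectively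
  \<open>p\<^sup>e\<close>, is at least a constant multiple of the modulus, and the summand is \<open>O(log q / q)\<close>; for
  the sum over \<open>p\<close> one uses that the sum of \<open>log p\<close> over \<open>p\<close> dividing \<open>q\<close> is at most
  \<open>log q\<close>. If it vanishes, then \<open>r\<close> has one of the special forms in the definition of the
  rating, and the summand has exactly the value prescribed there.
\<close>

section \<open>Sizes of totients and of the von Mangoldt function\<close>

lemma prime_power_le_totient:
  assumes "prime p" "k > 0"
  shows "real (p ^ k) \<le> 2 * real (totient (p ^ k))"
proof -
  have "p ^ k = p ^ (k - 1) * p"
    using assms(2) by (cases k) auto
  also have "\<dots> \<le> p ^ (k - 1) * (2 * (p - 1))"
    using prime_ge_2_nat[OF assms(1)] by (intro mult_left_mono) auto
  also have "\<dots> = 2 * totient (p ^ k)"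
    using assms by (simp add: totient_prime_power)
  finally show ?thesis by linarith
qed

text \<open>Off prime powers \<open>mangoldt\<close> vanishes, and at prime powers the totient is at
  least half the argument.\<close>

lemma mangoldt_div_totient_le:
  assumes "n > 0"
  shows "mangoldt n / real (totient n) \<le> 2 * (ln (real n) / real n)"
proof (cases "primepow n")
  case True
  then obtain p k where p: "prime p" "k > 0" "n = p ^ k"
    unfolding primepow_def by blast
  have *: "real n \<le> 2 * real (totient n)"
    using prime_power_le_totient[OF p(1,2)] by (simp only: p(3))
  have "mangoldt n / real (totient n) \<le> ln (real n) / real (totient n)"
    using mangoldt_le[of n] assms by (intro divide_right_mono) auto
  also have "\<dots> \<le> ln (real n) / (real n / 2)"
    using * assms by (intro divide_left_mono) auto
  finally show ?thesis by (simp add: mult.commute)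
qed (use assms in \<open>simp add: mangoldt_def\<close>)

text \<open>The common last step of the error estimates: a divisor or residue \<open>n\<close> of
  size at least \<open>q / M\<close> costs only \<open>M\<close> times the target rate. Bounding
  numerator and denominator separately avoids monotonicity of \<open>ln x / x\<close>, which fails
  for small \<open>x\<close>.\<close>

lemma ln_div_self_le:
  assumes "n > 0" "n \<le> q" "real q \<le> M * real n"
  shows "ln (real n) / real n \<le> M * (ln (real q) / real q)"
proof -
  have "ln (real n) / real n \<le> ln (real q) / real n"
    using assms by (intro divide_right_mono) auto
  also have "\<dots> = ln (real q) * (real q / real n) / real q"
    using assms by simp
  also have "\<dots> \<le> ln (real q) * M / real q"
    using assms by (intro divide_right_mono mult_left_mono) (auto simp: field_simps)
  finally show ?thesis by (simp add: mult_ac)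
qed

section \<open>Least positive residues and congruences with inverses\<close>

lemma least_pos_residue:
  assumes "q > 0"
  shows "least_pos_residue q a > 0" "[int (least_pos_residue q a) = a] (mod int q)"
    "least_pos_residue q a \<le> q"
proof -
  \<comment> \<open>The representative lies in \<open>{1..q}\<close>, so the class of
    \<open>0\<close> is represented by \<open>q\<close>; this also covers
    \<open>q = 1\<close>.\<close>
  define w where "w = (if a mod int q = 0 then q else nat (a mod int q))"
  have "0 \<le> a mod int q" "a mod int q < int q"
    using assms by simp_all
  hence w: "w > 0" "[int w = a] (mod int q)" "w \<le> q"
    using assms by (auto simp: w_def cong_def simp del: pos_mod_sign pos_mod_bound)
  show "least_pos_residue q a > 0" "[int (least_pos_residue q a) = a] (mod int q)"
    using LeastI[of "\<lambda>m. m > 0 \<and> [int m = a] (mod int q)" w] w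
    by (auto simp: least_pos_residue_def)
  show "least_pos_residue q a \<le> q"
    using Least_le[of "\<lambda>m. m > 0 \<and> [int m = a] (mod int q)" w] w
    by (auto simp: least_pos_residue_def)
qed

text \<open>Two members of \<open>{1..q}\<close> that are congruent modulo \<open>q\<close> differ
  by less than \<open>q\<close>, hence agree.\<close>

lemma least_pos_residue_eqI:
  assumes "m > 0" "m \<le> q" "[int m = a] (mod int q)"
  shows "least_pos_residue q a = m"
proof -
  let ?l = "least_pos_residue q a"
  have q: "q > 0" using assms by simp
  note l = least_pos_residue[OF q, of a]
  have "[int m = int ?l] (mod int q)"
    using cong_trans[OF assms(3) cong_sym[OF l(2)]] .
  hence "int q dvd int m - int ?l" by (simp add: cong_iff_dvd_diff)
  moreover have "\<bar>int m - int ?l\<bar> < int q"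
    using l assms by linarith
  ultimately have "int m - int ?l = 0"
    using dvd_imp_le_int[of "int m - int ?l" "int q"] by auto
  thus ?thesis by simp
qed

lemma cong_modular_inverse_iff:
  fixes m t x :: int
  assumes "coprime t m"
  shows "[x = modular_inverse m t] (mod m) \<longleftrightarrow> [x * t = 1] (mod m)"
proof -
  have "[x = modular_inverse m t] (mod m) \<longleftrightarrow> [x * t = modular_inverse m t * t] (mod m)"
    using assms by (simp add: cong_mult_rcancel)
  also have "\<dots> \<longleftrightarrow> [x * t = 1] (mod m)"
    using cong_modular_inverse2[OF assms] by (meson cong_sym cong_trans)
  finally show ?thesis .
qed

text \<open>The inverse is taken modulo \<open>q\<close> but the congruence is modulo a divisor
  \<open>m\<close>; an inverse modulo \<open>q\<close> remains one modulo \<open>m\<close>. This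
  turns the condition behind \<open>h\<close> at the inverse of \<open>a\<close> into a congruence
  between \<open>p ^ e\<close> and \<open>a\<close>.\<close>

lemma cong_mult_modular_inverse_iff:
  fixes m q t x :: int
  assumes "coprime t q" "m dvd q"
  shows "[x * modular_inverse q t = 1] (mod m) \<longleftrightarrow> [x = t] (mod m)"
proof -
  have inv: "[modular_inverse q t * t = 1] (mod m)"
    using cong_modular_inverse2[OF assms(1)] assms(2) by (rule cong_dvd_modulus)
  have cop: "coprime t m"
    using coprime_divisors[OF dvd_refl assms(2,1)] .
  have "[x * modular_inverse q t = 1] (mod m) \<longleftrightarrow>
        [x * modular_inverse q t * t = 1 * t] (mod m)"
    by (rule cong_mult_rcancel[OF cop, symmetric])
  also have "\<dots> \<longleftrightarrow> [x * 1 = t] (mod m)"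
  proof -
    have "[x * modular_inverse q t * t = x * 1] (mod m)"
      using cong_mult[OF cong_refl[of x] inv] by (simp add: mult.assoc)
    thus ?thesis by (simp add: cong_def)
  qed
  finally show ?thesis by simp
qed

section \<open>The exponent \<open>e_exp\<close> and the size of \<open>h\<close>\<close>

context
  fixes q p :: nat and t :: int and m
  defines "m \<equiv> q div p ^ multiplicity p q"
  assumes coprime: "coprime t (int q)" and q: "q > 0"
begin

lemma modulus_decompose: "q = p ^ multiplicity p q * m"
  unfolding m_def by (simp add: multiplicity_dvd)

text \<open>Multiplying by \<open>t\<close> removes the inverse; \<open>t\<close> is a unit modulo
  \<open>m\<close> because \<open>m\<close> divides \<open>q\<close>.\<close>

lemma e_exp_altdef:
  "e_exp q p t = Inf {enat e | e. e \<ge> 1 \<and> [int p ^ e * t = 1] (mod int m)}"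
proof -
  have "int m dvd int q"
    using modulus_decompose by (metis dvd_triv_right of_nat_dvd_iff)
  hence "coprime t (int m)"
    using coprime_divisors[OF dvd_refl _ coprime] by blast
  thus ?thesis
    by (simp add: e_exp_def m_def[symmetric] Let_def cong_modular_inverse_iff)
qed

text \<open>A finite infimum excludes the empty set, and in the well-order \<open>enat\<close> the
  infimum of a nonempty set is attained.\<close>

lemma e_exp_eq_enatD:
  assumes "e_exp q p t = enat e"
  shows "e \<ge> 1" "[int p ^ e * t = 1] (mod int m)"
proof -
  let ?S = "{enat e | e. e \<ge> 1 \<and> [int p ^ e * t = 1] (mod int m)}"
  have "?S \<noteq> {}"
    using assms unfolding e_exp_altdef by (metis (no_types, lifting) Inf_enat_def enat.distinct(1))
  then obtain x where "x \<in> ?S" by blast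
  hence "(LEAST x. x \<in> ?S) \<in> ?S" by (rule LeastI)
  hence "e_exp q p t \<in> ?S"
    unfolding e_exp_altdef using \<open>?S \<noteq> {}\<close> by (simp only: Inf_enat_def if_False)
  thus "e \<ge> 1" "[int p ^ e * t = 1] (mod int m)"
    unfolding assms by auto
qed

lemma e_exp_eqI:
  assumes "e \<ge> 1" "[int p ^ e * t = 1] (mod int m)"
    "\<And>i. 1 \<le> i \<Longrightarrow> i < e \<Longrightarrow> \<not> [int p ^ i * t = 1] (mod int m)"
  shows "e_exp q p t = enat e"
  unfolding e_exp_altdef
proof (rule Inf_eqI)
  fix x assume "x \<in> {enat e | e. e \<ge> 1 \<and> [int p ^ e * t = 1] (mod int m)}"
  thus "enat e \<le> x" using assms(3) by (auto simp: not_less[symmetric])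
qed (use assms in auto)

text \<open>With \<open>\<nu> = multiplicity p q\<close>, the factor \<open>p ^ \<nu>\<close> of
  \<open>q\<close> is at most \<open>2 * totient (p ^ \<nu>)\<close> and the factor \<open>m\<close>
  is at most \<open>C * p ^ e\<close>, so the weight of \<open>ln p\<close> in \<open>h\<close> is
  at most \<open>2 * C / q\<close>. If no exponent exists, \<open>h\<close> is
  \<open>0\<close>.\<close>

lemma h_bounds:
  assumes p: "prime p"
    and C: "\<And>e. e \<ge> 1 \<Longrightarrow> [int p ^ e * t = 1] (mod int m) \<Longrightarrow> real m \<le> C * real p ^ e"
    and "C \<ge> 0" "p dvd q"
  shows "h q p t \<ge> 0" "h q p t \<le> 2 * C / real q * ln (real p)"
proof -
  let ?v = "multiplicity p q"
  have p1: "real p \<ge> 1" using prime_ge_1_nat[OF p] by simp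
  show "h q p t \<ge> 0"
    using p1 by (auto simp: h_def split: enat.splits)
  show "h q p t \<le> 2 * C / real q * ln (real p)"
  proof (cases "e_exp q p t")
    case (enat e)
    have v: "?v > 0"
      using assms(4) p q by (simp add: prime_multiplicity_gt_zero_iff)
    have phi: "real (p ^ ?v) \<le> 2 * real (totient (p ^ ?v))"
      using prime_power_le_totient[OF p v] .
    have "real q = real (p ^ ?v) * real m"
      using modulus_decompose by (metis of_nat_mult)
    also have "\<dots> \<le> (2 * real (totient (p ^ ?v))) * (C * real p ^ e)"
      using phi C[OF e_exp_eq_enatD[OF enat]] by (intro mult_mono) auto
    finally have *: "real q \<le> 2 * C * (real (totient (p ^ ?v)) * real p ^ e)"
      by (simp add: mult_ac)
    have pos: "real (totient (p ^ ?v)) * real p ^ e > 0"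
      using p1 by (intro mult_pos_pos) (auto simp: totient_gt_0_iff prime_gt_0_nat[OF p])
    have "1 / (real (totient (p ^ ?v)) * real p ^ e) \<le> 2 * C / real q"
      using * pos q by (simp add: field_simps)
    hence "1 / (real (totient (p ^ ?v)) * real p ^ e) * ln (real p) \<le> 2 * C / real q * ln (real p)"
      using p1 by (intro mult_right_mono) auto
    thus ?thesis by (simp add: h_def enat)
  qed (use p1 \<open>C \<ge> 0\<close> in \<open>simp add: h_def\<close>)
qed

end

section \<open>Sums of \<open>h\<close> over the primes dividing \<open>q\<close>\<close>

text \<open>Since \<open>ln p = mangoldt p\<close> at primes, this is a partial sum of the
  divisor-sum identity for \<open>mangoldt\<close>.\<close>

lemma sum_ln_prime_factors_le:
  assumes "q > 0" "P \<subseteq> prime_factors q"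
  shows "(\<Sum>p\<in>P. ln (real p)) \<le> ln (real q)"
proof -
  have "(\<Sum>p\<in>P. ln (real p)) = (\<Sum>p\<in>P. mangoldt p)"
  proof (intro sum.cong refl)
    fix p assume "p \<in> P"
    hence "prime p" using assms(2) by (blast intro: in_prime_factors_imp_prime)
    thus "ln (real p) = mangoldt p" by simp
  qed
  also have "\<dots> \<le> (\<Sum>d | d dvd q. mangoldt d)"
    using assms by (intro sum_mono2) (auto simp: mangoldt_nonneg)
  also have "\<dots> = ln (real q)"
    using mangoldt_sum[of q, where ?'a = real] assms by simp
  finally show ?thesis .
qed

text \<open>Keeping the weight \<open>ln p\<close> in the bound for each \<open>h q p t\<close>
  makes the whole sum cost a single \<open>ln q\<close>, however many primes divide
  \<open>q\<close>. The subset \<open>P\<close> leaves room for removing an exceptional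
  prime.\<close>

lemma sum_h_bounds:
  assumes "coprime t (int q)" "q > 0" "C \<ge> 0" "P \<subseteq> prime_factors q"
    and C: "\<And>p e. p \<in> P \<Longrightarrow> e \<ge> 1 \<Longrightarrow> [int p ^ e * t = 1] (mod int (q div p ^ multiplicity p q))
      \<Longrightarrow> real (q div p ^ multiplicity p q) \<le> C * real p ^ e"
  shows "\<bar>\<Sum>p\<in>P. h q p t\<bar> \<le> 2 * C * (ln (real q) / real q)"
proof -
  have h: "h q p t \<ge> 0 \<and> h q p t \<le> 2 * C / real q * ln (real p)" if "p \<in> P" for p
  proof -
    have "prime p" "p dvd q"
      using that assms(4) by (blast intro: in_prime_factors_imp_prime in_prime_factors_imp_dvd)+
    thus ?thesis
      using h_bounds[OF assms(1,2) \<open>prime p\<close> C[OF that] \<open>C \<ge> 0\<close>] by blast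
  qed
  hence "\<bar>\<Sum>p\<in>P. h q p t\<bar> = (\<Sum>p\<in>P. h q p t)"
    by (simp add: sum_nonneg)
  also have "\<dots> \<le> 2 * C / real q * (\<Sum>p\<in>P. ln (real p))"
    unfolding sum_distrib_left using h by (intro sum_mono) auto
  also have "\<dots> \<le> 2 * C / real q * ln (real q)"
    using sum_ln_prime_factors_le[OF assms(2,4)] \<open>C \<ge> 0\<close> by (intro mult_left_mono) auto
  finally show ?thesis by simp
qed

text \<open>Only the pair \<open>(P, E)\<close> may escape the bound. An admissible exponent below
  \<open>E\<close> at \<open>P\<close> would obey the bound and contradict \<open>large\<close>, so
  \<open>e_exp q P t = E\<close> and the term at \<open>P\<close> is explicit; the other primes fall
  under \<open>sum_h_bounds\<close>.\<close>

lemma sum_h_exceptional: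
  assumes "coprime t (int q)" "q > 0" "C \<ge> 0"
    and C: "\<And>p e. p \<in> prime_factors q \<Longrightarrow> e \<ge> 1 \<Longrightarrow>
      [int p ^ e * t = 1] (mod int (q div p ^ multiplicity p q)) \<Longrightarrow>
      real (q div p ^ multiplicity p q) \<le> C * real p ^ e \<or> p = P \<and> e = E"
    and P: "prime P" "P dvd q" "multiplicity P q = V" "E \<ge> 1"
      "[int P ^ E * t = 1] (mod int (q div P ^ V))"
    and large: "real q > real P ^ V * (C * real P ^ E)"
  shows "\<bar>(\<Sum>p\<in>prime_factors q. h q p t) - ln (real P) / (real (totient (P ^ V)) * real P ^ E)\<bar>
           \<le> 2 * C * (ln (real q) / real q)"
proof -
  have P_in: "P \<in> prime_factors q"
    using P \<open>q > 0\<close> by (simp add: in_prime_factors_iff)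
  have "e_exp q P t = enat E"
  proof (rule e_exp_eqI[OF assms(1,2)])
    show "[int P ^ E * t = 1] (mod int (q div P ^ multiplicity P q))"
      using P by simp
    fix i assume i: "1 \<le> i" "i < E"
    show "\<not> [int P ^ i * t = 1] (mod int (q div P ^ multiplicity P q))"
    proof
      assume "[int P ^ i * t = 1] (mod int (q div P ^ multiplicity P q))"
      hence "real (q div P ^ V) \<le> C * real P ^ i"
        using C[OF P_in i(1)] i(2) P(3) by auto
      also have "\<dots> \<le> C * real P ^ E"
        using i \<open>C \<ge> 0\<close> prime_ge_1_nat[OF P(1)] by (intro mult_left_mono power_increasing) auto
      finally have "real P ^ V * real (q div P ^ V) \<le> real P ^ V * (C * real P ^ E)"
        by (intro mult_left_mono) auto
      moreover have "real q = real P ^ V * real (q div P ^ V)"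
        using modulus_decompose[OF assms(1,2), of P] P(3) by (metis of_nat_mult of_nat_power)
      ultimately show False using large by linarith
    qed
  qed (use P in auto)
  hence hP: "h q P t = ln (real P) / (real (totient (P ^ V)) * real P ^ E)"
    using P by (simp add: h_def)
  have "(\<Sum>p\<in>prime_factors q. h q p t) = h q P t + (\<Sum>p\<in>prime_factors q - {P}. h q p t)"
    using P_in by (intro sum.remove) auto
  moreover have "\<bar>\<Sum>p\<in>prime_factors q - {P}. h q p t\<bar> \<le> 2 * C * (ln (real q) / real q)"
    using C by (intro sum_h_bounds assms) auto
  ultimately show ?thesis using hP by simp
qed

text \<open>A nonzero multiple of \<open>m\<close> has absolute value at least
  \<open>\<bar>m\<bar>\<close>; since \<open>v \<ge> 1\<close>, the constant
  \<open>\<bar>w\<bar>\<close> is absorbed into \<open>\<bar>w\<bar> * v\<close>. It is applied with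
  \<open>v\<close> a residue or a power \<open>p ^ e\<close>.\<close>

lemma abs_le_if_dvd:
  fixes m u v x :: int
  assumes "m dvd u * (x * v - w)" "x * v \<noteq> w" "u > 0" "v > 0"
  shows "\<bar>m\<bar> \<le> u * (\<bar>x\<bar> + \<bar>w\<bar>) * v"
proof -
  have "\<bar>m\<bar> \<le> \<bar>u * (x * v - w)\<bar>"
    using assms by (intro dvd_imp_le_int) auto
  also have "\<dots> = u * \<bar>x * v - w\<bar>" using assms by (simp add: abs_mult)
  also have "\<bar>x * v - w\<bar> \<le> \<bar>x\<bar> * v + \<bar>w\<bar> * 1"
    using abs_triangle_ineq4[of "x * v" w] assms by (simp add: abs_mult)
  also have "\<bar>w\<bar> * 1 \<le> \<bar>w\<bar> * v"
    using assms by (intro mult_left_mono) auto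
  finally show ?thesis using assms by (simp add: algebra_simps)
qed

section \<open>The integer \<open>a = r + s * q\<close> for fixed \<open>r = c / f\<close> and
  \<open>s = b / d\<close>\<close>

context
  fixes r s :: rat and c f b :: int and d :: nat and A :: "nat \<Rightarrow> int"
  assumes r: "r = of_int c / of_int f" "f > 0" "coprime c f"
    and s: "s = of_int b / of_nat d" "d > 0" "coprime b (int d)"
  defines "A \<equiv> \<lambda>q. \<lfloor>r + s * of_nat q\<rfloor>"
begin

text \<open>On \<open>Q_set r s\<close> the floor in \<open>A\<close> changes nothing; the third
  fact is the cleared equation by which \<open>A q\<close> is eliminated below.\<close>

lemma Q_setD:
  assumes "q \<in> Q_set r s"
  shows "q > 0" "coprime (A q) (int q)" "int d * (f * A q) = int d * c + f * (b * int q)"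
proof -
  from assms obtain a :: int where q: "q > 0" and
    a: "of_int a = r + s * of_nat q" "coprime a (int q)"
    by (auto simp: Q_set_def)
  have A: "A q = a" unfolding A_def a(1)[symmetric] by simp
  show "q > 0" "coprime (A q) (int q)" using q a A by simp_all
  have "(of_int a :: rat) = of_int c / of_int f + of_int b / of_nat d * of_nat q"
    using a(1) unfolding r(1) s(1) .
  hence "(of_nat d * (of_int f * of_int a) :: rat) = of_nat d * of_int c + of_int f * (of_int b * of_nat q)"
    using r(2) s(2) by (simp add: field_simps)
  hence "(of_int (int d * (f * a)) :: rat) = of_int (int d * c + f * (b * int q))"
    by simp
  thus "int d * (f * A q) = int d * c + f * (b * int q)"
    unfolding A by (subst (asm) of_int_eq_iff)
qed

text \<open>By the cleared equation \<open>f\<close> divides \<open>d * c\<close>, and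
  \<open>f\<close> is coprime to \<open>c\<close>.\<close>

lemma f_dvd_d:
  assumes "q \<in> Q_set r s"
  shows "f dvd int d"
proof -
  have "int d * c = f * (int d * A q - b * int q)"
    using Q_setD(3)[OF assms] by (simp add: algebra_simps)
  hence "f dvd int d * c" by simp
  thus ?thesis using r(3) by (simp add: coprime_commute coprime_dvd_mult_left_iff)
qed

section \<open>The terms \<open>K\<close> and \<open>iota\<close>\<close>

text \<open>Let \<open>g\<close> be the gcd of \<open>q\<close> and \<open>a - 1\<close>. For
  \<open>r = 1\<close> the equation reads \<open>d * (a - 1) = b * q\<close>, whence
  \<open>d * g = q\<close> by coprimality of \<open>b\<close> and \<open>d\<close>, and
  \<open>q / g\<close> is exactly \<open>d\<close>. Otherwise \<open>g\<close> divides the nonzero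
  \<open>d * (c - f)\<close>, so \<open>q / g\<close> is comparable to \<open>q\<close>. The
  quotient at \<open>q\<close> itself is always an error term.\<close>

lemma K_bound:
  assumes q: "q \<in> Q_set r s"
  shows "\<bar>K q (A q - 1) - (if r = 1 then mangoldt d / real (totient d) else 0)\<bar> \<le> (2 * real_of_int \<bar>int d * (c - f)\<bar> + 2) * (ln (real q) / real q)"
proof -
  let ?L = "ln (real q) / real q"
  define g where "g = nat (gcd (int q) (A q - 1))"
  define n where "n = q div g"
  note D = Q_setD[OF q]
  have g0: "int g = gcd (int q) (A q - 1)" "g > 0" using D(1) by (auto simp: g_def)
  have "g dvd q" by (metis g0(1) gcd_dvd1 of_nat_dvd_iff)
  hence qn: "q = g * n" unfolding n_def by simp
  have n: "n > 0" "n \<le> q" using qn D(1) g0 by auto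
  have K: "K q (A q - 1) = mangoldt n / real (totient n) - mangoldt q / real (totient q)"
    by (simp add: K_def g_def n_def Let_def)
  have 1: "0 \<le> mangoldt q / real (totient q)" "mangoldt q / real (totient q) \<le> 2 * ?L"
    using mangoldt_div_totient_le[OF D(1)] by (simp_all add: mangoldt_nonneg)
  have L: "?L \<ge> 0" using D(1) by simp
  show ?thesis
  proof (cases "r = 1")
    case True
    hence "c = f" using r(1,2) by simp
    hence "f = 1" "c = 1" using r(2,3) by auto
    hence *: "int d * (A q - 1) = b * int q" using D(3) by (simp add: algebra_simps)
    have "int d * int g = gcd (int d * int q) (int d * (A q - 1))"
      unfolding g0(1) using gcd_mult_distrib_int[of "int d"] by simp
    also have "\<dots> = gcd (int d) b * int q"
      unfolding * using gcd_mult_distrib_int[of "int q" "int d" b] by (simp add: mult.commute)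
    also have "gcd (int d) b = 1" using s(3) by (simp add: coprime_iff_gcd_eq_1 gcd.commute)
    finally have "d * g = g * n" using qn by (metis mult_1 of_nat_eq_iff of_nat_mult)
    hence "n = d" using g0(2) by simp
    thus ?thesis using 1 L True by (simp add: K \<open>c = f\<close>)
  next
    case False
    hence cf: "c \<noteq> f" using r(1,2) by auto
    have "int g dvd int d * (f * (A q - 1)) - f * b * int q"
    proof (intro dvd_diff)
      show "int g dvd int d * (f * (A q - 1))" "int g dvd f * b * int q"
        unfolding g0(1) by (simp_all add: mult.assoc[symmetric])
    qed
    also have "int d * (f * (A q - 1)) - f * b * int q = int d * (c - f)"
      using D(3) by (simp add: algebra_simps)
    finally have "int g \<le> \<bar>int d * (c - f)\<bar>"
      using cf s(2) dvd_imp_le_int[of "int d * (c - f)" "int g"] by simp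
    hence "real g \<le> real_of_int \<bar>int d * (c - f)\<bar>" by linarith
    hence "real q \<le> real_of_int \<bar>int d * (c - f)\<bar> * real n"
      unfolding qn of_nat_mult by (intro mult_right_mono) auto
    hence "ln (real n) / real n \<le> real_of_int \<bar>int d * (c - f)\<bar> * ?L"
      by (rule ln_div_self_le[OF n])
    hence "mangoldt n / real (totient n) \<le> 2 * (real_of_int \<bar>int d * (c - f)\<bar> * ?L)"
      using mangoldt_div_totient_le[OF n(1)] by linarith
    moreover have "mangoldt n / real (totient n) \<ge> 0" by (simp add: mangoldt_nonneg)
    ultimately have "\<bar>mangoldt n / real (totient n) - mangoldt q / real (totient q)\<bar>
      \<le> 2 * (real_of_int \<bar>int d * (c - f)\<bar> * ?L) + 2 * ?L"
      using 1 by linarith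
    thus ?thesis using False by (simp only: K if_False algebra_simps diff_0_right)
  qed
qed

text \<open>If \<open>q\<close> divides \<open>a + 1\<close>, it divides \<open>d * (c + f)\<close>,
  so for large \<open>q\<close> this vanishes and coprimality gives \<open>r = -1\<close>. Then
  \<open>d * (a + 1) = b * q\<close> makes \<open>d\<close> divide \<open>b\<close>, so
  \<open>d = 1\<close>. Hence there is no error term here.\<close>

lemma iota_eq:
  assumes q: "q \<in> Q_set r s" and large: "int q > \<bar>int d * (c + f)\<bar>"
  shows "iota q (- A q) * ln 2 = (if r = -1 \<and> d = 1 then ln 2 else 0)"
proof -
  note D = Q_setD[OF q]
  have iff: "[- A q = 1] (mod int q) \<longleftrightarrow> int q dvd A q + 1"
    by (metis cong_iff_dvd_diff dvd_minus_iff minus_diff_eq minus_minus add.commute diff_minus_eq_add)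
  have "int q dvd A q + 1 \<longleftrightarrow> r = -1 \<and> d = 1"
  proof
    assume *: "int q dvd A q + 1"
    hence "int q dvd int d * (f * (A q + 1)) - f * b * int q"
      by (intro dvd_diff dvd_mult) auto
    also have "int d * (f * (A q + 1)) - f * b * int q = int d * (c + f)"
      using D(3) by (simp add: algebra_simps)
    finally have "c + f = 0"
      using large s(2) dvd_imp_le_int[of "int d * (c + f)" "int q"] by auto
    hence c: "c = - f" by simp
    hence "f = 1" using r(2,3) by simp
    with c have r1: "r = -1" using r(1) by simp
    from * obtain u where u: "A q + 1 = int q * u" by blast
    have "int d * (A q + 1) = b * int q"
      using D(3) c \<open>f = 1\<close> by (simp add: algebra_simps)
    hence "int d * u = b" using D(1) u by simp
    hence "int d dvd b" by auto
    hence "d = 1" using s(3)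
      by (metis abs_of_nat coprime_common_divisor dvd_refl of_nat_1 of_nat_eq_iff zdvd1_eq)
    with r1 show "r = -1 \<and> d = 1" by simp
  next
    assume rd: "r = -1 \<and> d = 1"
    hence "(of_int c :: rat) = of_int (- f)" using r(1,2) by (simp add: field_simps)
    hence c: "c = - f" by (simp only: of_int_eq_iff)
    hence "f = 1" using r(2,3) by simp
    hence "A q + 1 = b * int q" using D(3) rd c by simp
    thus "int q dvd A q + 1" by simp
  qed
  thus ?thesis by (simp add: iota_def iff)
qed

section \<open>The two least positive residues\<close>

lemma residue_bound:
  assumes q: "q \<in> Q_set r s" and large: "int q > 2 * int d * \<bar>c\<bar>"
  defines "\<rho> \<equiv> least_pos_residue q (A q)"
  shows "\<bar>mangoldt \<rho> / real \<rho> - (if d = 1 \<and> c > 0 then mangoldt (nat c) / real (nat c) else 0)\<bar> \<le> 2 * real d * (ln (real q) / real q)"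
proof (cases "d = 1 \<and> c > 0")
  case True
  note D = Q_setD[OF q]
  have "f = 1" using f_dvd_d[OF q] True r(2) by simp
  hence "A q - c = b * int q" using D(3) True by simp
  hence "[c = A q] (mod int q)"
    by (metis cong_iff_dvd_diff cong_sym dvd_triv_right)
  hence "\<rho> = nat c"
    unfolding \<rho>_def using True large by (intro least_pos_residue_eqI) auto
  thus ?thesis using True D(1) by simp
next
  case False
  note D = Q_setD[OF q]
  note \<rho> = least_pos_residue[OF D(1), of "A q", folded \<rho>_def]
  from \<rho>(2) obtain u where u: "int \<rho> = A q + int q * u"
    by (metis cong_iff_lin cong_sym)
  \<comment> \<open>\<open>\<rho>\<close> satisfies the cleared equation with \<open>w\<close> in
    place of \<open>b\<close>. For large \<open>q\<close>, \<open>w \<le> -1\<close> would make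
    \<open>\<rho>\<close> negative, and \<open>w = 0\<close> gives \<open>d dvd b\<close>, so
    \<open>d = 1\<close> and \<open>\<rho> = c > 0\<close>, the excluded case.\<close>
  define w where "w = b + int d * u"
  have eq: "int d * (f * int \<rho>) = int d * c + f * (w * int q)"
    using D(3) by (simp add: u w_def algebra_simps)
  have "w > 0"
  proof (rule ccontr)
    assume "\<not> w > 0"
    then consider "w = 0" | "w \<le> -1" by linarith
    thus False
    proof cases
      case 1
      hence "int d dvd b" unfolding w_def by (metis add_eq_0_iff dvd_minus_iff dvd_triv_left)
      hence "d = 1" using s(3)
        by (metis abs_of_nat coprime_common_divisor dvd_refl of_nat_1 of_nat_eq_iff zdvd1_eq)
      moreover from this have "f = 1" using f_dvd_d[OF q] r(2) by simp
      ultimately show False using eq 1 \<rho>(1) False by simp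
    next
      case 2
      have "f * (w * int q) \<le> 1 * (-1 * int q)"
      proof -
        have "f * (-w * int q) \<ge> 1 * (1 * int q)"
          using 2 r(2) by (intro mult_mono) auto
        thus ?thesis by simp
      qed
      moreover have "int d * c \<le> int d * \<bar>c\<bar>" by (intro mult_left_mono) auto
      moreover have "int d * (f * int \<rho>) > 0" using s(2) r(2) \<rho>(1) by simp
      moreover have "int d * \<bar>c\<bar> \<ge> 0" by simp
      ultimately show False using eq large by linarith
    qed
  qed
  \<comment> \<open>\<open>f * q\<close> is at most
    \<open>d * f * \<rho> + d * \<bar>c\<bar>\<close>, and by \<open>large\<close> the second part
    takes up at most half of it; hence the factor \<open>2\<close>.\<close>
  hence "f * (1 * int q) \<le> f * (w * int q)" using r(2) by (intro mult_left_mono mult_right_mono) auto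
  moreover have "f * (2 * int d * \<bar>c\<bar>) \<le> f * int q" using large r(2) by (intro mult_left_mono) auto
  moreover have "- (f * (int d * \<bar>c\<bar>)) \<le> int d * c"
  proof -
    have "1 * (int d * \<bar>c\<bar>) \<le> f * (int d * \<bar>c\<bar>)" using r(2) by (intro mult_right_mono) auto
    moreover have "int d * (- \<bar>c\<bar>) \<le> int d * c" by (intro mult_left_mono) auto
    ultimately show ?thesis by simp
  qed
  ultimately have "f * int q \<le> f * (2 * int d * int \<rho>)"
    using eq by (simp add: algebra_simps)
  hence "int q \<le> int (2 * d * \<rho>)" using r(2) by simp
  hence "q \<le> 2 * d * \<rho>" by (simp only: of_nat_le_iff)
  hence "real q \<le> real (2 * d * \<rho>)" by (rule of_nat_mono)
  hence "real q \<le> (2 * real d) * real \<rho>" by simp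
  hence "ln (real \<rho>) / real \<rho> \<le> 2 * real d * (ln (real q) / real q)"
    by (rule ln_div_self_le[OF \<rho>(1,3)])
  moreover have "mangoldt \<rho> / real \<rho> \<le> ln (real \<rho>) / real \<rho>"
    using \<rho>(1) mangoldt_le[of \<rho>] by (intro divide_right_mono) auto
  moreover have "mangoldt \<rho> / real \<rho> \<ge> 0" by (simp add: mangoldt_nonneg)
  ultimately show ?thesis using False by (simp only: if_False)
qed

text \<open>For \<open>r = 1 / d\<close> the number \<open>d\<close> is an inverse of
  \<open>a\<close> modulo \<open>q\<close>, and \<open>large\<close> makes it the least positive
  one. Otherwise \<open>q\<close> divides \<open>d * (c * \<rho> - f)\<close>, which is
  nonzero.\<close>

lemma inverse_residue_bound:
  assumes q: "q \<in> Q_set r s" and large: "q \<ge> d"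
  defines "\<rho> \<equiv> least_pos_residue q (modular_inverse (int q) (A q))"
  shows "\<bar>mangoldt \<rho> / real \<rho> - (if r = 1 / of_nat d then mangoldt d / real d else 0)\<bar>
           \<le> real_of_int (int d * (\<bar>c\<bar> + f)) * (ln (real q) / real q)"
proof (cases "r = 1 / of_nat d")
  case True
  note D = Q_setD[OF q]
  have "(of_int f :: rat) = of_int (c * int d)"
    using True s(2) r(1,2) by (simp add: field_simps)
  hence f: "f = c * int d" by (simp only: of_int_eq_iff)
  hence "c dvd 1" using r(3) by (metis coprime_common_divisor dvd_refl dvd_triv_left)
  hence "c = 1" using f r(2) s(2) by (auto simp: zero_less_mult_iff)
  hence "int d * (int d * A q - 1) = int d * (b * int q)"
    using D(3) f by (simp add: algebra_simps)
  hence "int d * A q - 1 = b * int q" using s(2) by simp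
  hence "[int d * A q = 1] (mod int q)"
    by (simp add: cong_iff_dvd_diff)
  hence "\<rho> = d"
    unfolding \<rho>_def using large s(2) D(2)
    by (intro least_pos_residue_eqI) (simp_all add: cong_modular_inverse_iff)
  thus ?thesis using True D(1) r(2) by simp
next
  case False
  note D = Q_setD[OF q]
  note \<rho> = least_pos_residue[OF D(1), of "modular_inverse (int q) (A q)", folded \<rho>_def]
  have 1: "int q dvd int \<rho> * A q - 1"
    using \<rho>(2) unfolding cong_modular_inverse_iff[OF D(2)] by (simp only: cong_iff_dvd_diff)
  have "int q dvd int d * f * (int \<rho> * A q - 1) - f * b * int \<rho> * int q"
    by (rule dvd_diff[OF dvd_mult[OF 1] dvd_triv_right])
  also have "int d * f * (int \<rho> * A q - 1) - f * b * int \<rho> * int q =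
             int \<rho> * (int d * (f * A q)) - int d * f - f * b * int \<rho> * int q"
    by (simp add: algebra_simps)
  also have "\<dots> = int d * (c * int \<rho> - f)"
    unfolding D(3) by (simp add: algebra_simps)
  finally have 2: "int q dvd int d * (c * int \<rho> - f)" .
  \<comment> \<open>Equality would force \<open>c = 1\<close> and \<open>\<rho> = f\<close>;
    cancelling \<open>q\<close> then gives \<open>d dvd f\<close>, so \<open>f = d\<close> and
    \<open>r = 1 / d\<close>, the excluded case.\<close>
  have "c * int \<rho> \<noteq> f"
  proof
    assume *: "c * int \<rho> = f"
    hence "c dvd 1" using r(3) by (metis coprime_common_divisor dvd_refl dvd_triv_left)
    hence c: "c = 1" using * r(2) \<rho>(1) by (auto simp: zero_less_mult_iff)
    with * have f: "int \<rho> = f" by simp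
    from 1 obtain u where u: "f * A q - 1 = int q * u" unfolding f by blast
    have "int q * (int d * u) = int d * (f * A q - 1)"
      unfolding u by (simp add: mult_ac)
    also have "\<dots> = int q * (f * b)"
      using D(3) c by (simp add: right_diff_distrib mult_ac)
    finally have "int q * (int d * u) = int q * (f * b)" .
    hence "int d * u = f * b" using D(1) by simp
    hence "int d dvd f * b" by (metis dvd_triv_left)
    hence "int d dvd f" using s(3) by (simp add: coprime_commute coprime_dvd_mult_left_iff)
    hence "f = int d" using f_dvd_d[OF q] r(2) by (simp add: zdvd_antisym_nonneg)
    thus False using False r(1) c by simp
  qed
  from abs_le_if_dvd[OF 2 this] have "int q \<le> int d * (\<bar>c\<bar> + f) * int \<rho>"
    using s(2) r(2) \<rho>(1) by simp
  hence "real_of_int (int q) \<le> real_of_int (int d * (\<bar>c\<bar> + f) * int \<rho>)"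
    by (simp only: of_int_le_iff)
  hence "real q \<le> real_of_int (int d * (\<bar>c\<bar> + f)) * real \<rho>" by simp
  hence "ln (real \<rho>) / real \<rho> \<le> real_of_int (int d * (\<bar>c\<bar> + f)) * (ln (real q) / real q)"
    by (rule ln_div_self_le[OF \<rho>(1,3)])
  moreover have "mangoldt \<rho> / real \<rho> \<le> ln (real \<rho>) / real \<rho>"
    using \<rho>(1) mangoldt_le[of \<rho>] by (intro divide_right_mono) auto
  moreover have "mangoldt \<rho> / real \<rho> \<ge> 0" by (simp add: mangoldt_nonneg)
  ultimately show ?thesis using False by (simp only: if_False)
qed

section \<open>Congruences modulo \<open>q / p ^ \<nu>\<close>\<close>

lemma denom_prime_powerE:
  fixes n u :: int
  assumes "int d * n = b * int p ^ e" "prime p"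
  obtains k where "d = p ^ k"
proof -
  have "int d dvd b * int p ^ e" using assms(1) by (metis dvd_triv_left)
  hence "int d dvd int (p ^ e)"
    using s(3) by (simp add: coprime_commute coprime_dvd_mult_right_iff)
  hence "d dvd p ^ e" by (simp only: of_nat_dvd_iff)
  thus ?thesis using that assms(2) by (metis divides_primepow_nat)
qed

text \<open>Eliminating \<open>a\<close> gives \<open>m dvd d * (c * p ^ e - f)\<close>. If this is
  nonzero, the bound follows; if it vanishes, then \<open>c = 1\<close> and
  \<open>f = p ^ e\<close>, and cancelling \<open>m\<close> in the cleared equation leaves
  \<open>d\<close> as a power of \<open>p\<close>.\<close>

lemma modulus_le:
  assumes q: "q \<in> Q_set r s" and p: "prime p" "p dvd q"
    and cong: "[int p ^ e * A q = 1] (mod int (q div p ^ multiplicity p q))" and e: "e \<ge> 1"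
  shows "real (q div p ^ multiplicity p q) \<le> real_of_int (int d * (\<bar>c\<bar> + f)) * real p ^ e
           \<or> (\<exists>k. d = p ^ k \<and> e < k \<and> r = 1 / of_nat p ^ e)"
proof -
  note D = Q_setD[OF q]
  define m where "m = q div p ^ multiplicity p q"
  note qm = modulus_decompose[OF D(2,1), of p, folded m_def]
  have qm': "int q = int p ^ multiplicity p q * int m"
    using qm by (metis of_nat_mult of_nat_power)
  have m: "m > 0" using qm D(1) by (auto intro: Nat.gr0I)
  have dvd: "int m dvd int p ^ e * A q - 1"
    using cong by (simp add: m_def cong_iff_dvd_diff)
  have "int m dvd int d * f * (int p ^ e * A q - 1) - f * b * int p ^ e * int q"
    unfolding qm' by (rule dvd_diff[OF dvd_mult[OF dvd] dvd_mult[OF dvd_triv_right]])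
  also have "int d * f * (int p ^ e * A q - 1) - f * b * int p ^ e * int q =
             int p ^ e * (int d * (f * A q)) - int d * f - f * b * int p ^ e * int q"
    by (simp add: algebra_simps)
  also have "\<dots> = int d * (c * int p ^ e - f)"
    unfolding D(3) by (simp add: algebra_simps)
  finally have 1: "int m dvd int d * (c * int p ^ e - f)" .
  have p0: "int p ^ e > 0" using prime_gt_0_nat[OF p(1)] by simp
  show ?thesis
  proof (cases "c * int p ^ e = f")
    case False
    from abs_le_if_dvd[OF 1 this] have "int m \<le> int d * (\<bar>c\<bar> + f) * int p ^ e"
      using s(2) r(2) p0 by simp
    hence "real_of_int (int m) \<le> real_of_int (int d * (\<bar>c\<bar> + f) * int p ^ e)"
      by (simp only: of_int_le_iff)
    thus ?thesis by (simp add: m_def)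
  next
    case True
    hence "c dvd 1" using r(3) by (metis coprime_common_divisor dvd_refl dvd_triv_left)
    hence c: "c = 1" using True r(2) p0 by (auto simp: zero_less_mult_iff)
    with True have f: "f = int p ^ e" by simp
    have "f * (int d * (f * A q - 1)) = f * (int p ^ e * (b * int q))"
      using D(3) unfolding c f by (simp add: algebra_simps)
    hence eq: "int d * (int p ^ e * A q - 1) = int p ^ e * (b * int q)"
      unfolding f using p0 by (subst (asm) mult_left_cancel) auto
    obtain n where n: "int p ^ e * A q - 1 = int m * n" using dvd by blast
    have "int m * (int d * n) = int m * (b * int p ^ (e + multiplicity p q))"
      using eq unfolding n qm' by (simp add: power_add mult_ac)
    hence "int d * n = b * int p ^ (e + multiplicity p q)" using m by simp
    then obtain k where k: "d = p ^ k" using denom_prime_powerE p(1) by metis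
    \<comment> \<open>For \<open>e \<ge> k\<close> the number \<open>p ^ e * a - 1\<close> would be
      a multiple of \<open>q\<close>, hence of \<open>p\<close>, although
      \<open>e \<ge> 1\<close>.\<close>
    have "e < k"
    proof (rule ccontr)
      assume "\<not> e < k"
      hence "int p ^ e = int d * int p ^ (e - k)" by (simp add: k power_add[symmetric])
      hence "int d * (int p ^ e * A q - 1) = int d * (int p ^ (e - k) * (b * int q))"
        using eq by simp
      hence "int p ^ e * A q - 1 = int p ^ (e - k) * (b * int q)" using s(2) by simp
      moreover have "int p dvd int q" using p by simp
      ultimately have "int p dvd int p ^ e * A q - 1" by simp
      moreover have "int p dvd int p ^ e * A q" using e by simp
      ultimately have "int p dvd 1" by (meson dvd_diff_right_iff)
      thus False using p(1) by (simp add: prime_nat_iff)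
    qed
    moreover have "r = 1 / of_nat p ^ e" using r(1) c f by simp
    ultimately show ?thesis using k by blast
  qed
qed

text \<open>Converse to the exceptional case of \<open>modulus_le\<close>. The equation reduces to
  \<open>p ^ (k - e) * (p ^ e * a - 1) = b * q\<close> with \<open>b\<close> prime to
  \<open>p\<close>, so \<open>p ^ (k - e)\<close> divides \<open>q\<close>; since
  \<open>p ^ e * a - 1\<close> is prime to \<open>p\<close>, this power is exact.\<close>

lemma exceptional_prime:
  assumes q: "q \<in> Q_set r s" and p: "prime p" "d = p ^ k" "1 \<le> e" "e < k" "r = 1 / of_nat p ^ e"
  shows "p dvd q" "multiplicity p q = k - e" "[int p ^ e * A q = 1] (mod int (q div p ^ (k - e)))"
proof -
  note D = Q_setD[OF q]
  have p0: "p > 0" using prime_gt_0_nat[OF p(1)] .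
  have "(of_int f :: rat) = of_int (c * int p ^ e)"
    using p(5) p0 r(1,2) by (simp add: field_simps)
  hence f: "f = c * int p ^ e" by (simp only: of_int_eq_iff)
  hence "c dvd 1" using r(3) by (metis coprime_common_divisor dvd_refl dvd_triv_left)
  hence c: "c = 1" using f r(2) p0 by (auto simp: zero_less_mult_iff)
  have dd: "int d = int p ^ e * int p ^ (k - e)"
    using p by (simp add: power_add[symmetric])
  have "(int p ^ e * int p ^ e) * (int p ^ (k - e) * (int p ^ e * A q - 1)) =
        int d * (f * A q) * int p ^ e - int d * int p ^ e"
    using f c by (simp add: dd right_diff_distrib mult_ac)
  also have "\<dots> = (int p ^ e * int p ^ e) * (b * int q)"
    unfolding D(3) using f c by (simp add: algebra_simps)
  finally have eq: "int p ^ (k - e) * (int p ^ e * A q - 1) = b * int q"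
    using p0 by simp
  have "coprime (int p ^ (k - e)) b"
    using s(3) dd by (simp add: coprime_commute)
  moreover have "int p ^ (k - e) dvd b * int q" using eq by (metis dvd_triv_left)
  ultimately have "int (p ^ (k - e)) dvd int q" by (simp add: coprime_dvd_mult_right_iff)
  hence "p ^ (k - e) dvd q" by (simp only: of_nat_dvd_iff)
  then obtain m where m: "q = p ^ (k - e) * m" by blast
  have "int p ^ (k - e) * (int p ^ e * A q - 1) = int p ^ (k - e) * (b * int m)"
    using eq by (simp add: m mult_ac)
  hence eq': "int p ^ e * A q - 1 = b * int m" using p0 by simp
  have "\<not> p dvd m"
  proof
    assume "p dvd m"
    hence "int p dvd int p ^ e * A q - 1" unfolding eq' by simp
    moreover have "int p dvd int p ^ e * A q" using p(3) by simp
    ultimately have "int p dvd 1" by (meson dvd_diff_right_iff)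
    thus False using p(1) by (simp add: prime_nat_iff)
  qed
  thus "multiplicity p q = k - e"
    using m p0 by (intro multiplicity_decomposeI) auto
  show "p dvd q" unfolding m using p(4) by simp
  show "[int p ^ e * A q = 1] (mod int (q div p ^ (k - e)))"
    using eq' p0 by (simp add: m cong_iff_dvd_diff)
qed

text \<open>The elimination of \<open>modulus_le\<close> with \<open>c\<close> and \<open>f\<close>
  exchanged: \<open>m dvd d * (f * p ^ e - c)\<close>, and vanishing forces \<open>f = 1\<close> and
  \<open>c = p ^ e\<close>.\<close>

lemma modulus_le_inverse:
  assumes q: "q \<in> Q_set r s" and p: "prime p" "p dvd q"
    and cong: "[int p ^ e = A q] (mod int (q div p ^ multiplicity p q))" and e: "e \<ge> 1"
  shows "real (q div p ^ multiplicity p q) \<le> real_of_int (int d * (\<bar>c\<bar> + f)) * real p ^ e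
           \<or> (\<exists>k. k \<ge> 1 \<and> d = p ^ k \<and> r = of_nat p ^ e)"
proof -
  note D = Q_setD[OF q]
  define m where "m = q div p ^ multiplicity p q"
  note qm = modulus_decompose[OF D(2,1), of p, folded m_def]
  have qm': "int q = int p ^ multiplicity p q * int m"
    using qm by (metis of_nat_mult of_nat_power)
  have m: "m > 0" using qm D(1) by (auto intro: Nat.gr0I)
  have dvd: "int m dvd int p ^ e - A q"
    using cong by (simp add: m_def cong_iff_dvd_diff)
  have "int m dvd int d * f * (int p ^ e - A q) + f * b * int q"
    unfolding qm' by (rule dvd_add[OF dvd_mult[OF dvd] dvd_mult[OF dvd_triv_right]])
  also have "int d * f * (int p ^ e - A q) + f * b * int q = int d * (f * int p ^ e - c)"
    using D(3) by (simp add: algebra_simps)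
  finally have 1: "int m dvd int d * (f * int p ^ e - c)" .
  have p0: "int p ^ e > 0" using prime_gt_0_nat[OF p(1)] by simp
  show ?thesis
  proof (cases "f * int p ^ e = c")
    case False
    from abs_le_if_dvd[OF 1 this] have "int m \<le> int d * (\<bar>c\<bar> + f) * int p ^ e"
      using s(2) r(2) p0 by (simp add: add.commute)
    hence "real_of_int (int m) \<le> real_of_int (int d * (\<bar>c\<bar> + f) * int p ^ e)"
      by (simp only: of_int_le_iff)
    thus ?thesis by (simp add: m_def)
  next
    case True
    hence "f dvd 1" using r(3) by (metis coprime_common_divisor dvd_refl dvd_triv_left)
    hence f: "f = 1" using r(2) by simp
    with True have c: "c = int p ^ e" by simp
    have eq: "int d * (A q - int p ^ e) = b * int q"
      using D(3) unfolding c f by (simp add: algebra_simps)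
    obtain n where n: "int p ^ e - A q = int m * n" using dvd by blast
    hence "A q - int p ^ e = int m * (- n)" by simp
    with eq have "int m * (int d * (- n)) = int m * (b * int p ^ multiplicity p q)"
      unfolding qm' by (simp add: mult_ac)
    hence "int d * (- n) = b * int p ^ multiplicity p q" using m by (subst (asm) mult_left_cancel) auto
    then obtain k where k: "d = p ^ k" using denom_prime_powerE p(1) by metis
    \<comment> \<open>For \<open>d = 1\<close> the prime \<open>p\<close> would divide
      \<open>a = p ^ e + b * q\<close> as well as \<open>q\<close>, against coprimality.\<close>
    have "k \<noteq> 0"
    proof
      assume "k = 0"
      hence "A q = int p ^ e + b * int q" using eq k by simp
      moreover have pq: "int p dvd int q" using p by simp
      ultimately have "int p dvd A q" using e by simp
      hence "is_unit (int p)" using pq D(2) by (rule coprime_common_divisor[rotated])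
      thus False using p(1) by (simp add: prime_nat_iff)
    qed
    moreover have "r = of_nat p ^ e" using r(1) c f by simp
    ultimately show ?thesis using k by (auto intro!: exI[of _ k])
  qed
qed

text \<open>Converse to the exceptional case of \<open>modulus_le_inverse\<close>. By
  \<open>p ^ k * (a - p ^ e) = b * q\<close> the power \<open>p ^ k\<close> divides
  \<open>q\<close>; a further factor \<open>p\<close> of \<open>q\<close> would divide
  \<open>a - p ^ e\<close> and hence \<open>a\<close>.\<close>

lemma exceptional_prime_inverse:
  assumes q: "q \<in> Q_set r s" and p: "prime p" "d = p ^ k" "1 \<le> k" "1 \<le> e" "r = of_nat p ^ e"
  shows "p dvd q" "multiplicity p q = k" "[int p ^ e = A q] (mod int (q div p ^ k))"
proof -
  note D = Q_setD[OF q]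
  have p0: "p > 0" using prime_gt_0_nat[OF p(1)] .
  have "(of_int c :: rat) = of_int (f * int p ^ e)"
    using p(5) r(1,2) by (simp add: field_simps)
  hence c: "c = f * int p ^ e" by (simp only: of_int_eq_iff)
  hence "f dvd 1" using r(3) by (metis coprime_common_divisor dvd_refl dvd_triv_left)
  hence f: "f = 1" using r(2) by simp
  have eq: "int p ^ k * (A q - int p ^ e) = b * int q"
    using D(3) p(2) c f by (simp add: algebra_simps)
  have "coprime (int p ^ k) b"
    using s(3) p(2) by (simp add: coprime_commute)
  moreover have "int p ^ k dvd b * int q" using eq by (metis dvd_triv_left)
  ultimately have "int (p ^ k) dvd int q" by (simp add: coprime_dvd_mult_right_iff)
  hence "p ^ k dvd q" by (simp only: of_nat_dvd_iff)
  then obtain m where m: "q = p ^ k * m" by blast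
  show pq: "p dvd q" unfolding m using p(3) by simp
  have "int p ^ k * (A q - int p ^ e) = int p ^ k * (b * int m)"
    using eq by (simp add: m mult_ac)
  hence eq': "A q - int p ^ e = b * int m" using p0 by simp
  have "\<not> p dvd m"
  proof
    assume "p dvd m"
    hence "int p dvd (A q - int p ^ e) + int p ^ e" unfolding eq' using p(4) by (intro dvd_add) auto
    hence "int p dvd A q" by simp
    moreover have "int p dvd int q" using pq by simp
    ultimately have "is_unit (int p)" using D(2) by (rule coprime_common_divisor[rotated])
    thus False using p(1) by (simp add: prime_nat_iff)
  qed
  thus "multiplicity p q = k"
    using m p0 by (intro multiplicity_decomposeI) auto
  have "[A q = int p ^ e] (mod int m)" using eq' by (simp add: cong_iff_dvd_diff)
  thus "[int p ^ e = A q] (mod int (q div p ^ k))"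
    using p0 by (simp add: m cong_sym_eq)
qed


section \<open>Main terms of the two sums over primes\<close>

lemma sum_h_bound:
  defines "C \<equiv> real_of_int (int d * (\<bar>c\<bar> + f))"
  assumes q: "q \<in> Q_set r s" and large: "real q > real d * C"
  shows "\<bar>(\<Sum>p\<in>prime_factors q. h q p (A q)) -
           (if \<exists>p k e. prime p \<and> d = p ^ k \<and> 1 \<le> e \<and> e < k \<and> r = 1 / of_nat p ^ e
            then mangoldt d / real (totient d) else 0)\<bar> \<le> 2 * C * (ln (real q) / real q)"
proof -
  note D = Q_setD[OF q]
  have C: "C \<ge> 0" using r(2) by (simp add: C_def)
  note bound = modulus_le[OF q in_prime_factors_imp_prime in_prime_factors_imp_dvd, folded C_def]
  show ?thesis
  proof (cases "\<exists>p k e. prime p \<and> d = p ^ k \<and> 1 \<le> e \<and> e < k \<and> r = 1 / of_nat p ^ e")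
    case True
    then obtain P k E where P: "prime P" "d = P ^ k" "1 \<le> E" "E < k" "r = 1 / of_nat P ^ E"
      by blast
    \<comment> \<open>The prime is determined by \<open>d\<close> and the exponent by
      \<open>r\<close>, so at most one pair is exceptional.\<close>
    have unique: "p = P \<and> e = E"
      if "prime p" "d = p ^ l" "e < l" "r = 1 / of_nat p ^ e" for p l e
    proof
      show p: "p = P"
        using that P by (metis gr_zeroI less_zeroE prime_dvd_power primes_dvd_imp_eq dvd_power)
      have "(of_nat P ^ e :: rat) = of_nat P ^ E"
        using that(4) P(5) unfolding p by (metis div_by_1 divide_divide_eq_right mult_1)
      thus "e = E" by (simp only: prime_power_eq_iff_rat[OF P(1)])
    qed
    note ex = exceptional_prime[OF q P]
    have "P ^ (k - E) * P ^ E = d"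
      using P by (simp add: power_add[symmetric])
    hence large': "real q > real P ^ (k - E) * (C * real P ^ E)"
      using large by (metis (no_types, lifting) mult.assoc mult.commute of_nat_mult of_nat_power)
    \<comment> \<open>As \<open>k - E > 0\<close>, the denominator of the exceptional term combines
      to \<open>totient (P ^ k)\<close>, the one in the rating.\<close>
    have "totient (P ^ (k - E)) * P ^ E = totient d"
      using P by (simp add: totient_prime_power power_add[symmetric] mult_ac)
    hence "real (totient d) = real (totient (P ^ (k - E))) * real P ^ E"
      by (metis of_nat_mult of_nat_power)
    moreover have "mangoldt d = ln (real P)" using P by simp
    moreover have "\<bar>(\<Sum>p\<in>prime_factors q. h q p (A q)) -
        ln (real P) / (real (totient (P ^ (k - E))) * real P ^ E)\<bar> \<le> 2 * C * (ln (real q) / real q)"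
      by (rule sum_h_exceptional[OF D(2,1) C _ P(1) ex(1,2) P(3) ex(3) large'])
        (use bound unique in_prime_factors_imp_prime in blast)
    ultimately show ?thesis using True by simp
  next
    case False
    have "\<bar>\<Sum>p\<in>prime_factors q. h q p (A q)\<bar> \<le> 2 * C * (ln (real q) / real q)"
      by (rule sum_h_bounds[OF D(2,1) C]) (use bound False in_prime_factors_imp_prime in blast)+
    thus ?thesis unfolding if_not_P[OF False] by simp
  qed
qed

text \<open>The exceptional denominator \<open>totient (P ^ k) * P ^ E\<close> is
  \<open>totient (P ^ (k + E))\<close>, written through \<open>d\<close> and
  \<open>r = P ^ E\<close> so that no choice of \<open>P\<close> enters the statement. In the
  threshold, \<open>\<bar>c\<bar>\<close> stands for \<open>P ^ E\<close>.\<close>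

lemma sum_h_inverse_bound:
  defines "C \<equiv> real_of_int (int d * (\<bar>c\<bar> + f))"
  assumes q: "q \<in> Q_set r s" and large: "real q > real d * \<bar>real_of_int c\<bar> * C"
  shows "\<bar>(\<Sum>p\<in>prime_factors q. h q p (modular_inverse (int q) (A q))) -
           (if \<exists>p k e. prime p \<and> 1 \<le> k \<and> d = p ^ k \<and> 1 \<le> e \<and> r = of_nat p ^ e
            then mangoldt d / real (totient (d * nat \<lfloor>r\<rfloor>)) else 0)\<bar> \<le> 2 * C * (ln (real q) / real q)"
proof -
  note D = Q_setD[OF q]
  have C: "C \<ge> 0" using r(2) by (simp add: C_def)
  have cop: "coprime (modular_inverse (int q) (A q)) (int q)"
    using D(2) by simp
  have cong: "[int p ^ e * modular_inverse (int q) (A q) = 1] (mod int (q div p ^ multiplicity p q)) \<longleftrightarrow>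
    [int p ^ e = A q] (mod int (q div p ^ multiplicity p q))" for p e
  proof (rule cong_mult_modular_inverse_iff[OF D(2)])
    have "q div p ^ multiplicity p q dvd q"
      using modulus_decompose[OF D(2,1), of p] by (metis dvd_triv_right)
    thus "int (q div p ^ multiplicity p q) dvd int q" by (simp only: of_nat_dvd_iff)
  qed
  note bound = modulus_le_inverse[OF q in_prime_factors_imp_prime in_prime_factors_imp_dvd, folded C_def cong]
  show ?thesis
  proof (cases "\<exists>p k e. prime p \<and> 1 \<le> k \<and> d = p ^ k \<and> 1 \<le> e \<and> r = of_nat p ^ e")
    case True
    then obtain P k E where P: "prime P" "d = P ^ k" "1 \<le> k" "1 \<le> E" "r = of_nat P ^ E"
      by blast
    have unique: "p = P \<and> e = E"
      if "prime p" "d = p ^ l" "1 \<le> l" "r = of_nat p ^ e" for p l e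
    proof
      show p: "p = P"
        using that P by (metis One_nat_def Suc_le_lessD prime_dvd_power primes_dvd_imp_eq dvd_power)
      have "(of_nat P ^ e :: rat) = of_nat P ^ E"
        using that(4) P(5) unfolding p by simp
      thus "e = E" by (simp only: prime_power_eq_iff_rat[OF P(1)])
    qed
    note ex = exceptional_prime_inverse[OF q P]
    have rP: "r = of_nat (P ^ E)" using P by simp
    have "nat \<lfloor>r\<rfloor> = P ^ E" unfolding rP by (simp only: floor_of_nat nat_int)
    moreover have "\<bar>real_of_int c\<bar> \<ge> real P ^ E"
    proof -
      have "(of_int c :: rat) = of_int (f * int P ^ E)"
        using P(5) r(1,2) by (simp add: field_simps)
      hence "c = f * int P ^ E" by (simp only: of_int_eq_iff)
      moreover have "1 * int P ^ E \<le> f * int P ^ E" using r(2) by (intro mult_right_mono) auto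
      ultimately have "int (P ^ E) \<le> \<bar>c\<bar>" by simp
      hence "real_of_int (int (P ^ E)) \<le> real_of_int \<bar>c\<bar>" by (simp only: of_int_le_iff)
      thus ?thesis by simp
    qed
    hence "real d * real P ^ E * C \<le> real d * \<bar>real_of_int c\<bar> * C"
      using C by (intro mult_right_mono mult_left_mono) auto
    hence large': "real q > real P ^ k * (C * real P ^ E)"
      using large P(2) by (simp add: mult_ac)
    have "totient (P ^ k) * P ^ E = totient (d * P ^ E)"
      using P by (simp add: totient_prime_power power_add[symmetric] mult_ac)
    hence "real (totient (d * P ^ E)) = real (totient (P ^ k)) * real P ^ E"
      by (metis of_nat_mult of_nat_power)
    moreover have "mangoldt d = ln (real P)" using P by simp
    moreover have "[int P ^ E * modular_inverse (int q) (A q) = 1] (mod int (q div P ^ k))"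
      using cong[of P E] ex(2,3) by simp
    hence "\<bar>(\<Sum>p\<in>prime_factors q. h q p (modular_inverse (int q) (A q))) -
        ln (real P) / (real (totient (P ^ k)) * real P ^ E)\<bar> \<le> 2 * C * (ln (real q) / real q)"
      by (rule sum_h_exceptional[OF cop D(1) C _ P(1) ex(1,2) P(4) _ large', rotated])
        (use bound unique in_prime_factors_imp_prime in blast)
    ultimately show ?thesis using True by simp
  next
    case False
    have "\<bar>\<Sum>p\<in>prime_factors q. h q p (modular_inverse (int q) (A q))\<bar> \<le> 2 * C * (ln (real q) / real q)"
      by (rule sum_h_bounds[OF cop D(1) C]) (use bound False in_prime_factors_imp_prime in blast)+
    thus ?thesis unfolding if_not_P[OF False] by simp
  qed
qed

section \<open>The rating as a sum of six main terms\<close>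

text \<open>The summands belong to \<open>K\<close>, \<open>iota\<close>, the two residues and the
  two prime sums, in this order. For a prime power \<open>d\<close> the form of \<open>r\<close>
  selects at most one of them. Otherwise \<open>mangoldt d = 0\<close> leaves only the second and
  third, which require \<open>d = 1\<close>.\<close>

lemma rating_eq:
  assumes "f dvd int d"
  shows "rating r s =
    (if r = 1 then mangoldt d / real (totient d) else 0) +
    (if r = -1 \<and> d = 1 then ln 2 else 0) +
    (if d = 1 \<and> c > 0 then mangoldt (nat c) / real (nat c) else 0) +
    (if r = 1 / of_nat d then mangoldt d / real d else 0) +
    (if \<exists>p k e. prime p \<and> d = p ^ k \<and> 1 \<le> e \<and> e < k \<and> r = 1 / of_nat p ^ e
     then mangoldt d / real (totient d) else 0) +
    (if \<exists>p k e. prime p \<and> 1 \<le> k \<and> d = p ^ k \<and> 1 \<le> e \<and> r = of_nat p ^ e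
     then mangoldt d / real (totient (d * nat \<lfloor>r\<rfloor>)) else 0)"
proof -
  have "s = Fract b (int d)" using s by (simp add: Fract_of_int_quotient)
  hence denom: "denom s = d"
    using s by (simp add: denom_def quotient_of_Fract normalize_stable)
  show ?thesis
  proof (cases "primepow d")
    case True
    then obtain P k where P: "prime P" "k \<ge> 1" "d = P ^ k"
      unfolding primepow_def by (metis One_nat_def Suc_leI)
    have "d \<noteq> 1" using True by auto
    have unique: "p = P \<and> l = k" if "prime p" "d = p ^ l" "1 \<le> l" for p l
    proof
      show p: "p = P"
        using that P by (metis One_nat_def Suc_le_lessD prime_dvd_power primes_dvd_imp_eq dvd_power)
      show "l = k" using that(2) P prime_gt_1_nat[OF P(1)] unfolding p by simp
    qed
    have L: "mangoldt d = ln (real P)" using P by simp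
    have ne: "(1 / of_nat P ^ i :: rat) \<noteq> of_nat P ^ j" if "j \<ge> 1" for i j
      using prime_power_ne_inverse_rat[OF P(1) that] .
    have inj: "(1 / of_nat P ^ i :: rat) = 1 / of_nat P ^ j \<longleftrightarrow> i = j" for i j
      using prime_power_eq_iff_rat[OF P(1), of i j] prime_gt_0_nat[OF P(1)] by (auto simp: field_simps)
    have inj0: "(1 / of_nat P ^ i :: rat) = 1 \<longleftrightarrow> i = 0" for i
      using inj[of i 0] by simp
    have iff1: "(\<exists>p k e. prime p \<and> d = p ^ k \<and> 1 \<le> e \<and> e < k \<and> r = 1 / of_nat p ^ e) \<longleftrightarrow>
        (\<exists>e. 1 \<le> e \<and> e < k \<and> r = 1 / of_nat P ^ e)"
    proof
      assume "\<exists>p k e. prime p \<and> d = p ^ k \<and> 1 \<le> e \<and> e < k \<and> r = 1 / of_nat p ^ e"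
      then obtain p l e where *: "prime p" "d = p ^ l" "1 \<le> e" "e < l" "r = 1 / of_nat p ^ e"
        by blast
      with unique[of p l] have "p = P" "l = k" by simp_all
      with * show "\<exists>e. 1 \<le> e \<and> e < k \<and> r = 1 / of_nat P ^ e" by blast
    qed (use P in blast)
    have iff2: "(\<exists>p k e. prime p \<and> 1 \<le> k \<and> d = p ^ k \<and> 1 \<le> e \<and> r = of_nat p ^ e) \<longleftrightarrow>
        (\<exists>j\<ge>1. r = of_nat P ^ j)"
    proof
      assume "\<exists>p k e. prime p \<and> 1 \<le> k \<and> d = p ^ k \<and> 1 \<le> e \<and> r = of_nat p ^ e"
      then obtain p l e where *: "prime p" "1 \<le> l" "d = p ^ l" "1 \<le> e" "r = of_nat p ^ e"
        by blast
      with unique[of p l] have "p = P" by simp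
      with * show "\<exists>j\<ge>1. r = of_nat P ^ j" by blast
    qed (use P in blast)
    have d: "(of_nat d :: rat) = of_nat P ^ k" using P by simp
    note rating = denom[unfolded P(3)]
    \<comment> \<open>Admitting \<open>j = 0\<close> places \<open>r = 1\<close> among the inverse
      powers, which are disjoint from the positive powers.\<close>
    consider (power) j where "j \<ge> 1" "r = of_nat P ^ j" | (inverse) j where "j \<le> k" "r = 1 / of_nat P ^ j"
      | (other) "\<And>j. j \<ge> 1 \<Longrightarrow> r \<noteq> of_nat P ^ j" "\<And>j. j \<le> k \<Longrightarrow> r \<noteq> 1 / of_nat P ^ j"
      by blast
    thus ?thesis
    proof cases
      case (power j)
      have rP: "r = of_nat (P ^ j)" using power by simp
      have fl: "nat \<lfloor>r\<rfloor> = P ^ j" unfolding rP by (simp only: floor_of_nat nat_int)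
      have no: "r \<noteq> 1" "r \<noteq> 1 / of_nat d" "\<not> (\<exists>e. 1 \<le> e \<and> e < k \<and> r = 1 / of_nat P ^ e)"
        unfolding d power(2) using ne[OF power(1)] ne[OF power(1), of 0] by (auto dest: sym)
      have yes: "\<exists>j\<ge>1. r = of_nat P ^ j" using power by blast
      have "d * nat \<lfloor>r\<rfloor> = P ^ (j + k)" unfolding fl P(3) by (simp add: power_add)
      thus ?thesis
        unfolding iff1 iff2 if_not_P[OF no(1)] if_not_P[OF no(2)] if_not_P[OF no(3)] if_P[OF yes]
        using rating_denom_prime_power[OF P(1,2) rating power(1)] \<open>d \<noteq> 1\<close>
        by (simp add: L power(2))
    next
      case (inverse j)
      have no: "\<not> (\<exists>j\<ge>1. r = of_nat P ^ j)"
        unfolding inverse(2) using ne by simp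
      have eqs: "r = 1 \<longleftrightarrow> j = 0" "r = 1 / of_nat d \<longleftrightarrow> j = k"
        "(\<exists>e. 1 \<le> e \<and> e < k \<and> r = 1 / of_nat P ^ e) \<longleftrightarrow> 1 \<le> j \<and> j < k"
        unfolding d inverse(2) inj inj0 by auto
      consider "j = 0" | "1 \<le> j" "j < k" | "j = k" "k \<noteq> 0" using inverse(1) by linarith
      thus ?thesis
      proof cases
        case 1
        thus ?thesis unfolding iff1 iff2 eqs if_not_P[OF no] using P \<open>d \<noteq> 1\<close> L
            rating_denom_one[OF P(1,2) rating] inverse(2) by simp
      next
        case 2
        thus ?thesis unfolding iff1 iff2 eqs if_not_P[OF no] using P \<open>d \<noteq> 1\<close> L
            rating_denom_inverse[OF P(1,2) rating 2] inverse(2) by simp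
      next
        case 3
        thus ?thesis unfolding iff1 iff2 eqs if_not_P[OF no] using P \<open>d \<noteq> 1\<close> L
            rating_denom_inverse_eq[OF P(1,2) rating] inverse(2) by simp
      qed
    next
      case other
      have "r \<noteq> 1" using other(2)[of 0] by simp
      moreover have "r \<noteq> 1 / of_nat d" unfolding d using other(2)[of k] by simp
      moreover have "\<not> (\<exists>e. 1 \<le> e \<and> e < k \<and> r = 1 / of_nat P ^ e)"
        using other(2) by simp
      moreover have "\<not> (\<exists>j\<ge>1. r = of_nat P ^ j)"
        using other(1) by simp
      moreover have "rating r s = 0"
        using rating_denom_other[OF P(1,2) rating, of r] other \<open>r \<noteq> 1\<close> by blast
      ultimately show ?thesis unfolding iff1 iff2 using \<open>d \<noteq> 1\<close> by (simp only: if_False) simp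
    qed
  next
    case False
    hence L: "mangoldt d = (0 :: real)" by (simp add: mangoldt_def)
    show ?thesis
    proof (cases "d = 1")
      case True
      hence "f = 1" using assms r(2) by simp
      hence rc: "r = of_int c" using r(1) by simp
      have "s \<in> \<int>" using s(1) True by simp
      have iff: "r \<in> \<nat> \<longleftrightarrow> c \<ge> 0"
      proof
        assume "c \<ge> 0"
        hence "r = of_nat (nat c)" by (simp add: rc)
        thus "r \<in> \<nat>" by (simp only: of_nat_in_Nats)
      qed (auto simp: rc elim!: Nats_cases)
      \<comment> \<open>\<open>mangoldt (nat c)\<close> reproduces the prime power test in
        \<open>rating\<close>; \<open>r = -1\<close> has \<open>c < 0\<close>, so the two terms
        never overlap.\<close>
      have "rating r s = (if r = -1 then ln 2 else 0) +
          (if c > 0 then mangoldt (nat c) / real (nat c) else 0)"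
        unfolding rating_def denom using \<open>s \<in> \<int>\<close> True
        by (auto simp: iff[unfolded rc] rc mangoldt_def not_less dest!: primepow_gt_0_nat)
      thus ?thesis unfolding L using True by simp
    next
      case False
      hence "s \<notin> \<int>" using denom denom_Ints by metis
      hence "rating r s = 0" using \<open>\<not> primepow d\<close> denom by (intro rating_other) auto
      thus ?thesis unfolding L using False by simp
    qed
  qed
qed

section \<open>Adding up the estimates\<close>

text \<open>For empty \<open>Q_set r s\<close> the filter is trivial; otherwise any member supplies
  \<open>f dvd d\<close> for \<open>rating_eq\<close>, and six estimates are added term by
  term.\<close>

lemma Delta_bigo:
  "(\<lambda>q. Delta q (A q) - rating r s)
     \<in> O[inf at_top (principal (Q_set r s))](\<lambda>q. ln (real q) / real q)"
proof (cases "Q_set r s = {}")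
  case False
  then obtain q0 where "q0 \<in> Q_set r s" by blast
  note rating = rating_eq[OF f_dvd_d[OF this]]
  define C where "C = real_of_int (int d * (\<bar>c\<bar> + f))"
  \<comment> \<open>One constant per summand in the order of \<open>rating_eq\<close>; the
    \<open>0\<close> belongs to \<open>iota\<close>, whose main term is exact.\<close>
  define B where "B = (2 * real_of_int \<bar>int d * (c - f)\<bar> + 2) + 0 + 2 * real d + C + 2 * C + 2 * C"
  \<comment> \<open>The threshold collects the largeness conditions of the six estimates.\<close>
  have "eventually (\<lambda>q. real q > max (max (real_of_int \<bar>int d * (c + f)\<bar>) (real_of_int (2 * int d * \<bar>c\<bar>)))
      (max (max (real d) (real d * C)) (real d * \<bar>real_of_int c\<bar> * C))) at_top"
    using filterlim_real_sequentially by (simp only: filterlim_at_top_dense)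
  hence "eventually (\<lambda>q. q \<in> Q_set r s \<longrightarrow>
      norm (Delta q (A q) - rating r s) \<le> B * norm (ln (real q) / real q)) at_top"
  proof (eventually_elim, intro impI)
    fix q assume large: "real q > max (max (real_of_int \<bar>int d * (c + f)\<bar>) (real_of_int (2 * int d * \<bar>c\<bar>)))
      (max (max (real d) (real d * C)) (real d * \<bar>real_of_int c\<bar> * C))"
    assume q: "q \<in> Q_set r s"
    have 1: "int q > \<bar>int d * (c + f)\<bar>" "int q > 2 * int d * \<bar>c\<bar>" "q \<ge> d"
      "real q > real d * C" "real q > real d * \<bar>real_of_int c\<bar> * C"
      using large unfolding max_less_iff_conj by linarith+
    have add: "\<bar>(x + y) - (u + v)\<bar> \<le> (k + l) * L"
      if "\<bar>x - u\<bar> \<le> k * L" "\<bar>y - v\<bar> \<le> l * L" for x y u v k l L :: real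
      using that unfolding distrib_right by linarith
    let ?inv = "modular_inverse (int q) (A q)"
    have Delta: "Delta q (A q) = K q (A q - 1) + iota q (- A q) * ln 2
        + mangoldt (least_pos_residue q (A q)) / real (least_pos_residue q (A q))
        + mangoldt (least_pos_residue q ?inv) / real (least_pos_residue q ?inv)
        + (\<Sum>p\<in>prime_factors q. h q p (A q)) + (\<Sum>p\<in>prime_factors q. h q p ?inv)"
      by (simp add: Delta_def H_def sum.distrib Let_def)
    have "\<bar>Delta q (A q) - rating r s\<bar> \<le> B * (ln (real q) / real q)"
      unfolding Delta rating B_def
      by (intro add K_bound[OF q] residue_bound[OF q 1(2)] inverse_residue_bound[OF q 1(3), folded C_def]
        sum_h_bound[OF q, folded C_def, OF 1(4)] sum_h_inverse_bound[OF q, folded C_def, OF 1(5)])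
        (simp add: iota_eq[OF q 1(1)])
    thus "norm (Delta q (A q) - rating r s) \<le> B * norm (ln (real q) / real q)"
      using Q_setD(1)[OF q] by simp
  qed
  thus ?thesis
    by (intro bigoI[of _ B]) (simp add: eventually_inf_principal)
qed simp

end

theorem theorem4p2:
  fixes r s :: rat
  shows "(\<lambda>q::nat. Delta q \<lfloor>r + s * of_nat q\<rfloor> - rating r s)
           \<in> O[inf at_top (principal (Q_set r s))](\<lambda>q. ln (real q) / real q)"
proof -
  obtain c f where r: "quotient_of r = (c, f)" by (cases "quotient_of r")
  obtain b d where s: "quotient_of s = (b, d)" by (cases "quotient_of s")
  have "d > 0" using quotient_of_denom_pos[OF s] .
  moreover have "s = of_int b / of_int d" using quotient_of_div[OF s] .
  ultimately have "s = of_int b / of_nat (nat d)" "nat d > 0" "coprime b (int (nat d))"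
    using quotient_of_coprime[OF s] by (simp_all add: of_nat_nat)
  thus ?thesis
    using Delta_bigo quotient_of_div[OF r] quotient_of_denom_pos[OF r] quotient_of_coprime[OF r]
    by blast
qed

end
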